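(* Suppose $G=1$. Then there exists a subset $\overline{\Psi}'\subseteq\overline{\Xi}'$ of the outer approximation $\overline{\Xi}'$ of the lifted support, with $R(\overline{\Psi}')=\Xi$, such that for every feasible solution $\boldsymbol{x}'$ of $\mathrm{Aff}\,\mathcal{P}'(\mathbb{P}',\overline{\Xi}')$ there is a feasible solution $\boldsymbol{x}$ of $\mathrm{Aff}\,\mathcal{P}(\mathbb{P},\Xi)$ with $$\boldsymbol{x}'(\boldsymbol{\xi}')=\boldsymbol{x}(R(\boldsymbol{\xi}'))\qquad\text{for all }\boldsymbol{\xi}'\in\overline{\Psi}'.$$
   Context: Notation: $[n]=\{1,\dots,n\}$. For a family of sets $\Xi=\{\Xi_g\}_{g\in[G]}$, the symbol $\Xi$ also denotes the union $\bigcup_g\Xi_g$ (similarly for the other families below); when $G=1$, $\Xi=\Xi_1$. Problem. The uncertain parameters $\boldsymbol{\xi}=(\boldsymbol{\xi}_1,\dots,\boldsymbol{\xi}_T)\in\mathbb{R}^N$ are revealed over stages $t\in[T]$, and $\boldsymbol{\xi}^t=(\boldsymbol{\xi}_1,\dots,\boldsymbol{\xi}_t)$. They are governed by a probability distribution $\mathbb{P}$ supported on a family of compact sets $\Xi=\{\Xi_g\}_{g\in[G]}$. Problem $\mathcal{P}(\mathbb{P},\Xi)$ is $$\min_{\boldsymbol{x}\in\mathcal{F}}\ \mathbb{E}_{\mathbb{P}}[\boldsymbol{c}(\tilde{\boldsymbol{\xi}})^\intercal\boldsymbol{x}(\tilde{\boldsymbol{\xi}})]\quad\text{s.t.}\quad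 \boldsymbol{A}_g\boldsymbol{x}(\boldsymbol{\xi})\le\boldsymbol{b}_g(\boldsymbol{\xi})\ \ \forall g\in[G],\ \boldsymbol{\xi}\in\Xi_g,$$ with $\boldsymbol{A}_g$ fixed matrices and $\boldsymbol{c}(\cdot),\boldsymbol{b}_g(\cdot)$ affine. $\mathcal{F}$ is the set of non-anticipative decision rules $\boldsymbol{x}(\cdot)=(\boldsymbol{x}_0,\boldsymbol{x}_1(\cdot),\dots,\boldsymbol{x}_T(\cdot))$: $\boldsymbol{x}_0$ is constant and $\boldsymbol{x}_t$ depends on $\boldsymbol{\xi}$ only through $\boldsymbol{\xi}^t$. Lifting. Matrices $\boldsymbol{E}_t$ define $\boldsymbol{\theta}_t=\boldsymbol{E}_t\boldsymbol{\xi}^t$; for each $t$ the linear map $\boldsymbol{E}^t:\boldsymbol{\xi}^t\mapsto\boldsymbol{\theta}^t=(\boldsymbol{\theta}_1,\dots,\boldsymbol{\theta}_t)$ is injective. Put $\boldsymbol{E}=\boldsymbol{E}^T$, $\Theta_g=\boldsymbol{E}\Xi_g\subseteq\mathbb{R}^I$, $\Theta=\bigcup_g\Theta_g$. For each $i\in[I]$ let $\underline{\theta}_i=\min_{\boldsymbol\theta\in\Theta}\theta_i$, $\overline{\theta}_i=\max_{\boldsymbol\theta\in\Theta}\theta_i$ and choose $\underline{\theta}_i=z_{i0}<z_{i1}<\dots<z_{iJ_i}=\overline{\theta}_i$. The folding operator $F$ has components, for $i\in[I],j\in[J_i]$: $F_{ij}(\theta_i)=0$ if $\theta_i<z_{i,j-1}$;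 $F_{ij}(\theta_i)=\theta_i-z_{i,j-1}$ if $\theta_i\in[z_{i,j-1},z_{ij}]$; $F_{ij}(\theta_i)=z_{ij}-z_{i,j-1}$ if $\theta_i>z_{ij}$. Lifted vectors $\boldsymbol{\xi}'\in\mathbb{R}^{N'}$, $N'=\sum_iJ_i$, have components $\xi'_{ij}$. The left-inverses are $\boldsymbol{E}^+=(\boldsymbol{E}^\intercal\boldsymbol{E})^{-1}\boldsymbol{E}^\intercal$ and $F^+$ with $F^+_i(\boldsymbol{\xi}')=\underline{\theta}_i+\sum_{j\in[J_i]}\xi'_{ij}$. Set $L=F\circ\boldsymbol{E}$, $R=\boldsymbol{E}^+\circ F^+$, $\Xi'_g=L(\Xi_g)$, and let $\mathbb{P}'$ be the push-forward of $\mathbb{P}$ under $L$. For a family $S=\{S_g\}_{g\in[G]}$ of subsets of $\mathbb{R}^{N'}$, $\mathcal{P}'(\mathbb{P}',S)$ is $$\min_{\boldsymbol{x}'\in\mathcal{F}'}\ \mathbb{E}_{\mathbb{P}'}[\boldsymbol{c}(R(\tilde{\boldsymbol{\xi}}'))^\intercal\boldsymbol{x}'(\tilde{\boldsymbol{\xi}}')]\quad\text{s.t.}\quad\boldsymbol{A}_g\boldsymbol{x}'(\boldsymbol{\xi}')\le\boldsymbol{b}_g(R(\boldsymbol{\xi}'))\ \ \forall g\in[G],\ \boldsymbol{\xi}'\in S_g,$$ where $\mathcal{F}'$ encodes non-anticipativity in the lifted space ($\boldsymbol{x}'_0$ is constant; $\boldsymbol{x}'_t$ depends only on the components $\xi'_{ij}$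 for which $\theta_i$ is a component of $\boldsymbol{\theta}^t$). $\mathrm{Aff}\,\mathcal{P}$ and $\mathrm{Aff}\,\mathcal{P}'$ denote the same problems with decision rules additionally restricted to be affine. Outer approximation. Let $[\underline{\boldsymbol\theta}_g,\overline{\boldsymbol\theta}_g]$ be the smallest hyperrectangle containing $\Theta_g$. Then $\overline{\Xi}'=\{\overline{\Xi}'_g\}_{g\in[G]}$ with $$\overline{\Xi}'_g=\{\boldsymbol{\xi}'\in\mathbb{R}^{N'}: F^+(\boldsymbol{\xi}')\in\Theta_g\}\cap\mathrm{conv}\big(F([\underline{\boldsymbol\theta}_g,\overline{\boldsymbol\theta}_g])\big).$$ *)

theory Defs
  imports "HOL-Probability.Probability"
begin

text \<open>
  A vector whose coordinates are revealed in stages is a \<^typ>\<open>real ^ 'a\<close> together with a map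
  \<open>stg\<close> assigning a stage to each coordinate.  The history up to stage \<open>t\<close>
  (\<open>\<xi>\<^sup>t\<close> in the usual notation) is represented by the zero-padded vector
  that keeps exactly the coordinates of stage at most \<open>t\<close>.
\<close>

definition history :: "('a::finite \<Rightarrow> nat) \<Rightarrow> nat \<Rightarrow> real ^ 'a \<Rightarrow> real ^ 'a" where
  "history stg t v = (\<chi> n. if stg n \<le> t then v $ n else 0)"

definition affine_map :: "('a::real_vector \<Rightarrow> 'b::real_vector) \<Rightarrow> bool" where
  "affine_map f \<longleftrightarrow> (\<exists>h v. linear h \<and> f = (\<lambda>x. h x + v))"


subsection \<open>Multistage problems\<close>

datatype 'x opt_problem = Opt_Problem (feasible: "'x set") (objective: "'x \<Rightarrow> real")

text \<open>
  Uncertain coordinates have stages at least 1, decision coordinates may have stage 0; the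
  condition below therefore forces stage-0 decisions to be constant.
\<close>

definition nonanticipative ::
    "('n::finite \<Rightarrow> nat) \<Rightarrow> ('m::finite \<Rightarrow> nat) \<Rightarrow> (real ^ 'n \<Rightarrow> real ^ 'm) set" where
  "nonanticipative stg dstg =
     {x. \<forall>m \<xi> \<eta>. history stg (dstg m) \<xi> = history stg (dstg m) \<eta> \<longrightarrow> x \<xi> $ m = x \<eta> $ m}"

text \<open>
  The order on \<^typ>\<open>real ^ 'r\<close> is componentwise.  All constraint systems share one row index
  type; systems of different sizes are padded with trivial rows.
\<close>

definition multistage_problem ::
    "('n::finite \<Rightarrow> nat) \<Rightarrow> ('m::finite \<Rightarrow> nat) \<Rightarrow> nat \<Rightarrow> (nat \<Rightarrow> real ^ 'm ^ 'r::finite)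
     \<Rightarrow> (nat \<Rightarrow> real ^ 'n \<Rightarrow> real ^ 'r) \<Rightarrow> (real ^ 'n \<Rightarrow> real ^ 'm) \<Rightarrow> (real ^ 'n) measure
     \<Rightarrow> (nat \<Rightarrow> (real ^ 'n) set) \<Rightarrow> (real ^ 'n \<Rightarrow> real ^ 'm) opt_problem" where
  "multistage_problem stg dstg G A b c P S = Opt_Problem
     {x \<in> nonanticipative stg dstg. \<forall>g\<in>{1..G}. \<forall>\<xi>\<in>S g. A g *v x \<xi> \<le> b g \<xi>}
     (\<lambda>x. \<integral>\<xi>. inner (c \<xi>) (x \<xi>) \<partial>P)"

definition affine_rules :: "('a::real_vector \<Rightarrow> 'b::real_vector) opt_problem
    \<Rightarrow> ('a \<Rightarrow> 'b) opt_problem" where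
  "affine_rules p = Opt_Problem {x \<in> feasible p. affine_map x} (objective p)"


subsection \<open>Folding, lifting and retraction\<close>

text \<open>
  The pairs \<open>(i, j)\<close> with \<open>1 \<le> j \<le> J i\<close> that index the lifted vectors are enumerated by a
  finite type \<open>'k\<close>: coordinate \<open>k\<close> of a lifted vector is the component with
  \<open>i = coord k\<close> and \<open>j = piece k\<close>.
\<close>

definition lifted_index :: "('i \<Rightarrow> nat) \<Rightarrow> ('k \<Rightarrow> 'i) \<Rightarrow> ('k \<Rightarrow> nat) \<Rightarrow> bool" where
  "lifted_index J coord piece \<longleftrightarrow>
     bij_betw (\<lambda>k. (coord k, piece k)) UNIV (SIGMA i:UNIV. {1..J i})"

definition transformed_support :: "real ^ 'n ^ 'i \<Rightarrow> nat \<Rightarrow> (nat \<Rightarrow> (real ^ 'n::finite) set)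
    \<Rightarrow> (real ^ 'i) set" where
  "transformed_support E G \<Xi> = (\<Union>g\<in>{1..G}. (\<lambda>\<xi>. E *v \<xi>) ` \<Xi> g)"

definition fold_component :: "('i \<Rightarrow> nat \<Rightarrow> real) \<Rightarrow> 'i \<Rightarrow> nat \<Rightarrow> real \<Rightarrow> real" where
  "fold_component z i j s =
     (if s < z i (j - 1) then 0
      else if s \<le> z i j then s - z i (j - 1)
      else z i j - z i (j - 1))"

definition fold_op :: "('i \<Rightarrow> nat \<Rightarrow> real) \<Rightarrow> ('k \<Rightarrow> 'i) \<Rightarrow> ('k \<Rightarrow> nat)
    \<Rightarrow> real ^ 'i::finite \<Rightarrow> real ^ 'k::finite" where
  "fold_op z coord piece \<theta> = (\<chi> k. fold_component z (coord k) (piece k) (\<theta> $ coord k))"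

text \<open>
  The lower end \<open>z i 0\<close> of the grid is the minimum of the \<open>i\<close>-th coordinate over the support.
\<close>

definition unfold_op :: "('i \<Rightarrow> nat \<Rightarrow> real) \<Rightarrow> ('k \<Rightarrow> 'i)
    \<Rightarrow> real ^ 'k::finite \<Rightarrow> real ^ 'i::finite" where
  "unfold_op z coord \<xi>' = (\<chi> i. z i 0 + (\<Sum>k | coord k = i. \<xi>' $ k))"

definition left_inverse :: "real ^ 'n ^ 'i \<Rightarrow> real ^ 'i ^ 'n" where
  "left_inverse E = matrix_inv (transpose E ** E) ** transpose E"

definition lift_op :: "real ^ 'n ^ 'i \<Rightarrow> ('i \<Rightarrow> nat \<Rightarrow> real) \<Rightarrow> ('k \<Rightarrow> 'i) \<Rightarrow> ('k \<Rightarrow> nat)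
    \<Rightarrow> real ^ 'n::finite \<Rightarrow> real ^ 'k::finite" where
  "lift_op E z coord piece = fold_op z coord piece \<circ> (\<lambda>\<xi>. E *v \<xi>)"

definition retract_op :: "real ^ 'n ^ 'i \<Rightarrow> ('i \<Rightarrow> nat \<Rightarrow> real) \<Rightarrow> ('k \<Rightarrow> 'i)
    \<Rightarrow> real ^ 'k::finite \<Rightarrow> real ^ 'n::finite" where
  "retract_op E z coord = (\<lambda>\<theta>. left_inverse E *v \<theta>) \<circ> unfold_op z coord"

definition lifted_problem ::
    "('i::finite \<Rightarrow> nat) \<Rightarrow> ('m::finite \<Rightarrow> nat) \<Rightarrow> real ^ 'n ^ 'i \<Rightarrow> ('i \<Rightarrow> nat \<Rightarrow> real)
     \<Rightarrow> ('k::finite \<Rightarrow> 'i) \<Rightarrow> nat \<Rightarrow> (nat \<Rightarrow> real ^ 'm ^ 'r::finite)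
     \<Rightarrow> (nat \<Rightarrow> real ^ 'n::finite \<Rightarrow> real ^ 'r) \<Rightarrow> (real ^ 'n \<Rightarrow> real ^ 'm)
     \<Rightarrow> (real ^ 'k) measure \<Rightarrow> (nat \<Rightarrow> (real ^ 'k) set)
     \<Rightarrow> (real ^ 'k \<Rightarrow> real ^ 'm) opt_problem" where
  "lifted_problem \<theta>stg dstg E z coord G A b c P' S =
     multistage_problem (\<theta>stg \<circ> coord) dstg G A
       (\<lambda>g. b g \<circ> retract_op E z coord) (c \<circ> retract_op E z coord) P' S"

text \<open>
  The box hull of the image of \<open>\<Xi> g\<close> is the smallest hyperrectangle containing it.
\<close>

definition outer_approx :: "real ^ 'n ^ 'i \<Rightarrow> ('i \<Rightarrow> nat \<Rightarrow> real) \<Rightarrow> ('k \<Rightarrow> 'i) \<Rightarrow> ('k \<Rightarrow> nat)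
    \<Rightarrow> (nat \<Rightarrow> (real ^ 'n::finite) set) \<Rightarrow> nat \<Rightarrow> (real ^ 'k::finite) set" where
  "outer_approx E z coord piece \<Xi> g =
     (let \<Theta> = (\<lambda>\<xi>. E *v \<xi>) ` \<Xi> g
      in {\<xi>'. unfold_op z coord \<xi>' \<in> \<Theta>} \<inter>
         convex hull (fold_op z coord piece ` ((\<lambda>B. \<exists>l u. B = cbox l u) hull \<Theta>)))"

end

theory Submission
  imports Defs
begin

text \<open>
  The folding operator is piecewise affine, but it agrees with an affine map at the vertices of the
  smallest box containing the transformed support: at the lower end of coordinate \<open>i\<close> all
  pieces are empty, at the upper end all pieces are full.  The affine map that fills all pieces
  of a coordinate to the same fraction, \<open>grid_normalise\<close> followed by \<open>fill_pieces\<close>,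
  interpolates these vertex values.  Since a box is the convex hull of its vertices, this map sends
  the whole box into the convex hull of the folded box, and on the box unfolding undoes it
  because the pieces of a coordinate add up to its range.

  Take \<open>\<Psi>'\<close> to be the image of the transformed support under this affine lifting.  An
  affine rule of the lifted problem that is feasible on the outer approximation is feasible on
  \<open>\<Psi>'\<close>, and composing it with the affine lifting gives an affine rule on the original support
  that takes the same values.  Non-anticipativity survives because each lifted component only
  depends on its own coordinate of \<open>E \<xi>\<close>, which is determined by the history of \<open>\<xi>\<close> up
  to the stage of that coordinate.
\<close>

section \<open>Affine maps and left inverses\<close>

lemma affine_map_compose:
  assumes "affine_map f" "affine_map g"
  shows "affine_map (\<lambda>x. f (g x))"
proof -
  obtain h v k w where "linear h" "f = (\<lambda>x. h x + v)" "linear k" "g = (\<lambda>x. k x + w)"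
    using assms unfolding affine_map_def by blast
  moreover from this have "linear (\<lambda>x. h (k x))"
    using linear_compose[of k h] by (simp add: o_def)
  ultimately show ?thesis
    unfolding affine_map_def
    by (intro exI[of _ "\<lambda>x. h (k x)"] exI[of _ "h w + v"]) (auto simp: linear_add)
qed

lemma linear_imp_affine_map: "linear f \<Longrightarrow> affine_map f"
  unfolding affine_map_def by (intro exI[of _ f] exI[of _ 0]) auto

text \<open>
  The Gram matrix of an injective matrix is invertible, since \<open>x \<bullet> (E\<^sup>T E x) = \<parallel>E x\<parallel>\<^sup>2\<close>
  shows that its kernel is trivial.
\<close>

lemma left_inverse_mult_vector:
  fixes E :: "real ^ 'n::finite ^ 'i::finite"
  assumes "inj (\<lambda>\<xi>. E *v \<xi>)"
  shows "left_inverse E *v (E *v \<xi>) = \<xi>"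
proof -
  let ?M = "transpose E ** E"
  have "x = 0" if "?M *v x = 0" for x
  proof -
    have "inner (E *v x) (E *v x) = inner x (transpose E *v (E *v x))"
      by (metis dot_lmul_matrix inner_commute transpose_matrix_vector)
    also have "\<dots> = 0"
      using that by (simp add: matrix_vector_mul_assoc)
    finally have "E *v x = E *v 0" by simp
    then show "x = 0" using assms by (meson injD)
  qed
  then have "\<exists>B. B ** ?M = mat 1"
    by (simp add: matrix_left_invertible_ker)
  then have "invertible ?M"
    using invertible_left_inverse by blast
  then have "matrix_inv ?M ** ?M = mat 1"
    unfolding matrix_inv_def invertible_def by (rule someI2_ex) simp
  then show ?thesis
    by (simp add: left_inverse_def matrix_vector_mul_assoc flip: matrix_mul_assoc)
qed


section \<open>Filling all pieces of a coordinate to the same fraction\<close>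

definition fill_pieces :: "('i \<Rightarrow> nat \<Rightarrow> real) \<Rightarrow> ('k \<Rightarrow> 'i) \<Rightarrow> ('k \<Rightarrow> nat)
    \<Rightarrow> real ^ 'i::finite \<Rightarrow> real ^ 'k::finite" where
  "fill_pieces z coord piece s =
     (\<chi> k. s $ coord k * (z (coord k) (piece k) - z (coord k) (piece k - 1)))"

text \<open>
  A coordinate with \<open>J i = 0\<close> has a constant value and no lifted components; division by zero
  sends it to the fraction \<open>0\<close>.
\<close>

definition grid_normalise :: "('i \<Rightarrow> nat \<Rightarrow> real) \<Rightarrow> ('i \<Rightarrow> nat) \<Rightarrow> real ^ 'i::finite \<Rightarrow> real ^ 'i" where
  "grid_normalise z J \<theta> = (\<chi> i. (\<theta> $ i - z i 0) / (z i (J i) - z i 0))"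

lemma linear_fill_pieces: "linear (fill_pieces z coord piece)"
  by (rule linearI) (simp_all add: fill_pieces_def vec_eq_iff algebra_simps)

lemma affine_map_grid_normalise: "affine_map (grid_normalise z J)"
  unfolding affine_map_def
proof (intro exI conjI)
  show "linear (\<lambda>\<theta>. (\<chi> i. \<theta> $ i / (z i (J i) - z i 0)) :: real ^ _)"
    by (rule linearI) (simp_all add: vec_eq_iff add_divide_distrib)
  show "grid_normalise z J =
      (\<lambda>\<theta>. (\<chi> i. \<theta> $ i / (z i (J i) - z i 0)) + (\<chi> i. - z i 0 / (z i (J i) - z i 0)))"
    by (simp add: grid_normalise_def fun_eq_iff vec_eq_iff diff_divide_distrib)
qed

lemma grid_less:
  fixes z :: "'i \<Rightarrow> nat \<Rightarrow> real"
  assumes step: "\<And>i j. j < J i \<Longrightarrow> z i j < z i (Suc j)" and "a < b" "b \<le> J i"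
  shows "z i a < z i b"
  using assms(2,3)
proof (induction b)
  case (Suc b)
  then show ?case using step[of b i] by (cases "a = b") auto
qed simp

lemma lifted_index_piece_bounds:
  assumes "lifted_index J coord piece"
  shows "1 \<le> piece k" "piece k \<le> J (coord k)"
  using bij_betw_apply[OF assms[unfolded lifted_index_def], of k] by auto

lemma lifted_index_bij_piece:
  assumes "lifted_index J coord piece"
  shows "bij_betw piece {k. coord k = i} {1..J i}"
proof -
  have inj: "inj (\<lambda>k. (coord k, piece k))"
    and img: "range (\<lambda>k. (coord k, piece k)) = (SIGMA i:UNIV. {1..J i})"
    using assms by (auto simp: lifted_index_def bij_betw_def)
  have "inj_on piece {k. coord k = i}"
    using inj by (auto simp: inj_on_def)
  moreover have "j \<in> piece ` {k. coord k = i}" if "j \<in> {1..J i}" for j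
  proof -
    have "(i, j) \<in> range (\<lambda>k. (coord k, piece k))" using that by (simp add: img)
    then show ?thesis by auto
  qed
  ultimately show ?thesis
    using lifted_index_piece_bounds[OF assms] by (auto simp: bij_betw_def)
qed

lemma unfold_fill_pieces:
  fixes z :: "'i::finite \<Rightarrow> nat \<Rightarrow> real"
  assumes index: "lifted_index J coord piece"
  shows "unfold_op z coord (fill_pieces z coord piece s) $ i
    = z i 0 + s $ i * (z i (J i) - z i 0)"
proof -
  have "(\<Sum>k | coord k = i. fill_pieces z coord piece s $ k)
      = s $ i * (\<Sum>k | coord k = i. z i (piece k) - z i (piece k - 1))"
    by (simp add: fill_pieces_def sum_distrib_left)
  also have "(\<Sum>k | coord k = i. z i (piece k) - z i (piece k - 1))
      = (\<Sum>j\<in>{1..J i}. z i j - z i (j - 1))"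
    by (rule sum.reindex_bij_betw[OF lifted_index_bij_piece[OF index]])
  also have "\<dots> = z i (J i) - z i 0"
    using sum_telescope''[of 0 "J i" "z i"] by simp
  finally show ?thesis by (simp add: unfold_op_def)
qed

lemma unfold_fill_grid_normalise:
  fixes z :: "'i::finite \<Rightarrow> nat \<Rightarrow> real"
  assumes "lifted_index J coord piece"
    and "\<And>i. z i 0 \<le> \<theta> $ i" "\<And>i. \<theta> $ i \<le> z i (J i)"
  shows "unfold_op z coord (fill_pieces z coord piece (grid_normalise z J \<theta>)) = \<theta>"
proof (rule vec_eq_iff[THEN iffD2], rule allI)
  fix i
  show "unfold_op z coord (fill_pieces z coord piece (grid_normalise z J \<theta>)) $ i = \<theta> $ i"
    using assms(2,3)[of i]
    by (cases "z i (J i) = z i 0") (simp_all add: unfold_fill_pieces[OF assms(1)] grid_normalise_def)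
qed


section \<open>The affine lifting stays in the outer approximation\<close>

text \<open>
  At a vertex of the unit cube every piece is empty or full, which is what folding does at the
  corresponding vertex of the box spanned by the end points of the grids.
\<close>

lemma fill_pieces_vertex:
  fixes z :: "'i::finite \<Rightarrow> nat \<Rightarrow> real"
  assumes index: "lifted_index J coord piece"
    and step: "\<And>i j. j < J i \<Longrightarrow> z i j < z i (Suc j)"
    and vertex: "\<And>i. s $ i = 0 \<or> s $ i = 1"
  shows "fill_pieces z coord piece s
    = fold_op z coord piece (\<chi> i. if s $ i = 0 then z i 0 else z i (J i))"
proof (rule vec_eq_iff[THEN iffD2], rule allI)
  fix k
  let ?i = "coord k" and ?j = "piece k"
  note less = grid_less[where J = J and z = z, OF step]
  have j: "1 \<le> ?j" "?j \<le> J ?i" by (rule lifted_index_piece_bounds[OF index])+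
  have mid: "z ?i (?j - 1) < z ?i ?j" using j by (intro less) auto
  have low: "z ?i 0 < z ?i (?j - 1)" if "?j \<noteq> 1" using that j by (intro less) auto
  have high: "z ?i ?j < z ?i (J ?i)" if "?j \<noteq> J ?i" using that j by (intro less) auto
  have "fold_component z ?i ?j (z ?i 0) = 0"
    using mid low by (cases "?j = 1") (simp_all add: fold_component_def)
  moreover have "fold_component z ?i ?j (z ?i (J ?i)) = z ?i ?j - z ?i (?j - 1)"
    using mid high by (cases "?j = J ?i") (simp_all add: fold_component_def)
  ultimately show "fill_pieces z coord piece s $ k =
      fold_op z coord piece (\<chi> i. if s $ i = 0 then z i 0 else z i (J i)) $ k"
    using vertex[of ?i] by (auto simp: fill_pieces_def fold_op_def)
qed

text \<open>
  The unit cube is the convex hull of its vertices, and linear maps commute with convex hulls, so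
  it suffices to look at vertices.
\<close>

lemma fill_pieces_in_convex_hull_fold:
  fixes z :: "'i::finite \<Rightarrow> nat \<Rightarrow> real"
  assumes index: "lifted_index J coord piece"
    and step: "\<And>i j. j < J i \<Longrightarrow> z i j < z i (Suc j)"
    and box: "\<And>v. (\<And>i. v $ i = z i 0 \<or> v $ i = z i (J i)) \<Longrightarrow> v \<in> B"
    and s: "\<And>i. 0 \<le> s $ i" "\<And>i. s $ i \<le> 1"
  shows "fill_pieces z coord piece s \<in> convex hull (fold_op z coord piece ` B)"
proof -
  let ?V = "{v :: real ^ 'i. \<forall>i. v $ i = 0 \<or> v $ i = 1}"
  have "{v :: real ^ 'i. \<forall>i\<in>Basis. v \<bullet> i = 0 \<or> v \<bullet> i = 1} = ?V"
    by (auto simp: Basis_vec_def inner_axis)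
  moreover have "s \<in> cbox 0 One"
    unfolding mem_box
  proof
    fix d :: "real ^ 'i" assume d: "d \<in> Basis"
    then obtain i where "d = axis i 1" by (auto simp: Basis_vec_def)
    then have "0 \<le> s \<bullet> d" "s \<bullet> d \<le> 1" using s by (simp_all add: inner_axis)
    then show "0 \<bullet> d \<le> s \<bullet> d \<and> s \<bullet> d \<le> One \<bullet> d"
      using d by simp
  qed
  ultimately have "s \<in> convex hull ?V"
    by (simp add: unit_interval_convex_hull)
  then have "fill_pieces z coord piece s \<in> convex hull (fill_pieces z coord piece ` ?V)"
    by (simp add: convex_hull_linear_image[OF linear_fill_pieces, symmetric])
  also have "\<dots> \<subseteq> convex hull (fold_op z coord piece ` B)"
  proof (intro hull_mono image_subsetI)
    fix v assume "v \<in> ?V"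
    then have "fill_pieces z coord piece v
        = fold_op z coord piece (\<chi> i. if v $ i = 0 then z i 0 else z i (J i))"
      by (intro fill_pieces_vertex[where z = z and J = J, OF index step]) auto
    moreover have "(\<chi> i. if v $ i = 0 then z i 0 else z i (J i)) \<in> B"
      by (rule box) simp
    ultimately show "fill_pieces z coord piece v \<in> fold_op z coord piece ` B" by blast
  qed
  finally show ?thesis .
qed

text \<open>
  Every box containing \<open>\<Theta>\<close> reaches at least from the infimum to the supremum of each coordinate,
  hence contains all combinations of these end points.
\<close>

lemma grid_vertex_in_box_hull:
  fixes \<Theta> :: "(real ^ 'i::finite) set" and z :: "'i \<Rightarrow> nat \<Rightarrow> real"
  assumes "\<Theta> \<noteq> {}"
    and "\<And>i. z i 0 = (INF \<theta>\<in>\<Theta>. \<theta> $ i)" "\<And>i. z i (J i) = (SUP \<theta>\<in>\<Theta>. \<theta> $ i)"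
    and grid: "\<And>\<theta> i. \<theta> \<in> \<Theta> \<Longrightarrow> z i 0 \<le> \<theta> $ i \<and> \<theta> $ i \<le> z i (J i)"
    and v: "\<And>i. v $ i = z i 0 \<or> v $ i = z i (J i)"
  shows "v \<in> (\<lambda>B. \<exists>l u. B = cbox l u) hull \<Theta>"
  unfolding hull_def
proof clarify
  fix l u :: "real ^ 'i" assume sub: "\<Theta> \<subseteq> cbox l u"
  obtain \<theta> where \<theta>: "\<theta> \<in> \<Theta>" using assms(1) by blast
  have "l $ i \<le> v $ i \<and> v $ i \<le> u $ i" for i
  proof -
    have "l $ i \<le> z i 0" "z i (J i) \<le> u $ i"
      unfolding assms(2,3) using sub assms(1)
      by (auto intro!: cINF_greatest cSUP_least simp: mem_box_cart)
    then show ?thesis using v[of i] grid[OF \<theta>, of i] by auto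
  qed
  then show "v \<in> cbox l u" by (simp add: mem_box_cart)
qed

lemma affine_lift_in_outer_approx:
  fixes E :: "real ^ 'n::finite ^ 'i::finite"
  assumes index: "lifted_index J coord piece"
    and step: "\<And>i j. j < J i \<Longrightarrow> z i j < z i (Suc j)"
    and ends: "\<And>i. z i 0 = (INF \<theta>\<in>(\<lambda>\<xi>. E *v \<xi>) ` \<Xi> g. \<theta> $ i)"
      "\<And>i. z i (J i) = (SUP \<theta>\<in>(\<lambda>\<xi>. E *v \<xi>) ` \<Xi> g. \<theta> $ i)"
    and grid: "\<And>\<xi> i. \<xi> \<in> \<Xi> g \<Longrightarrow> z i 0 \<le> (E *v \<xi>) $ i \<and> (E *v \<xi>) $ i \<le> z i (J i)"
    and "\<xi> \<in> \<Xi> g"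
  shows "fill_pieces z coord piece (grid_normalise z J (E *v \<xi>))
    \<in> outer_approx E z coord piece \<Xi> g"
proof -
  let ?\<Theta> = "(\<lambda>\<xi>. E *v \<xi>) ` \<Xi> g" and ?s = "grid_normalise z J (E *v \<xi>)"
  have "unfold_op z coord (fill_pieces z coord piece ?s) = E *v \<xi>"
    using grid[OF \<open>\<xi> \<in> \<Xi> g\<close>] by (intro unfold_fill_grid_normalise[OF index]) auto
  moreover have "fill_pieces z coord piece ?s
      \<in> convex hull (fold_op z coord piece ` ((\<lambda>B. \<exists>l u. B = cbox l u) hull ?\<Theta>))"
  proof (rule fill_pieces_in_convex_hull_fold[where J = J, OF index])
    show "z i j < z i (Suc j)" if "j < J i" for i j by (rule step[OF that])
    show "v \<in> (\<lambda>B. \<exists>l u. B = cbox l u) hull ?\<Theta>"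
      if "\<And>i. v $ i = z i 0 \<or> v $ i = z i (J i)" for v
      using grid \<open>\<xi> \<in> \<Xi> g\<close> by (intro grid_vertex_in_box_hull[OF _ ends _ that]) auto
    show "0 \<le> ?s $ i" "?s $ i \<le> 1" for i
      using grid[OF \<open>\<xi> \<in> \<Xi> g\<close>, of i] by (auto simp: grid_normalise_def divide_le_eq_1)
  qed
  ultimately show ?thesis
    using \<open>\<xi> \<in> \<Xi> g\<close> by (auto simp: outer_approx_def Let_def)
qed


section \<open>Non-anticipativity\<close>

text \<open>
  Block triangularity of \<open>E\<close>: a transformed coordinate of stage at most \<open>t\<close> only sees
  \<open>\<xi>\<close> through its history up to stage \<open>t\<close>.
\<close>

lemma causal_mult_history:
  fixes E :: "real ^ 'n::finite ^ 'i::finite"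
  assumes "\<And>i n. \<theta>stg i < stg n \<Longrightarrow> E $ i $ n = 0" and "\<theta>stg i \<le> t"
  shows "(E *v \<xi>) $ i = (E *v history stg t \<xi>) $ i"
proof -
  have "E $ i $ n * \<xi> $ n = E $ i $ n * history stg t \<xi> $ n" for n
    using assms(1)[of i n] assms(2) by (cases "stg n \<le> t") (simp_all add: history_def)
  then show ?thesis by (simp only: matrix_vector_mult_def vec_lambda_beta)
qed

lemma nonanticipative_compose_affine_lift:
  fixes E :: "real ^ 'n::finite ^ 'i::finite"
  assumes causal: "\<And>i n. \<theta>stg i < stg n \<Longrightarrow> E $ i $ n = 0"
    and x': "x' \<in> nonanticipative (\<theta>stg \<circ> coord) dstg"
  shows "(\<lambda>\<xi>. x' (fill_pieces z coord piece (grid_normalise z J (E *v \<xi>))))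
    \<in> nonanticipative stg dstg"
  unfolding nonanticipative_def
proof (intro CollectI allI impI)
  let ?D = "\<lambda>\<xi>. fill_pieces z coord piece (grid_normalise z J (E *v \<xi>))"
  fix m and \<xi> \<eta> :: "real ^ 'n"
  assume hist: "history stg (dstg m) \<xi> = history stg (dstg m) \<eta>"
  have "(E *v \<xi>) $ i = (E *v \<eta>) $ i" if "\<theta>stg i \<le> dstg m" for i
    using causal_mult_history[of \<theta>stg stg E i "dstg m", OF causal that] hist by metis
  then have "history (\<theta>stg \<circ> coord) (dstg m) (?D \<xi>) = history (\<theta>stg \<circ> coord) (dstg m) (?D \<eta>)"
    by (simp add: history_def vec_eq_iff fill_pieces_def grid_normalise_def)
  then show "x' (?D \<xi>) $ m = x' (?D \<eta>) $ m"
    using x' unfolding nonanticipative_def by blast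
qed


section \<open>Lifted affine rules are affine rules on the image of the affine lifting\<close>

theorem theorem1:
  fixes T G :: nat
    and stg :: "'n::finite \<Rightarrow> nat" and \<theta>stg :: "'i::finite \<Rightarrow> nat" and dstg :: "'m::finite \<Rightarrow> nat"
    and \<Xi> :: "nat \<Rightarrow> (real ^ 'n) set" and P :: "(real ^ 'n) measure"
    and A :: "nat \<Rightarrow> real ^ 'm ^ 'r::finite"
    and b :: "nat \<Rightarrow> real ^ 'n \<Rightarrow> real ^ 'r" and c :: "real ^ 'n \<Rightarrow> real ^ 'm"
    and E :: "real ^ 'n ^ 'i"
    and J :: "'i \<Rightarrow> nat" and z :: "'i \<Rightarrow> nat \<Rightarrow> real"
    and coord :: "'k::finite \<Rightarrow> 'i" and piece :: "'k \<Rightarrow> nat"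
  assumes "G = 1"
    and stages: "\<And>n. stg n \<in> {1..T}" "\<And>i. \<theta>stg i \<in> {1..T}" "\<And>m. dstg m \<in> {0..T}"
    and compact: "\<And>g. g \<in> {1..G} \<Longrightarrow> compact (\<Xi> g)"
    and distribution: "prob_space P" "sets P = sets borel" "AE \<xi> in P. \<xi> \<in> (\<Union>g\<in>{1..G}. \<Xi> g)"
    and affine_data: "affine_map c" "\<And>g. g \<in> {1..G} \<Longrightarrow> affine_map (b g)"
    and E_causal: "\<And>i n. \<theta>stg i < stg n \<Longrightarrow> E $ i $ n = 0"
    and E_inj: "\<And>t. t \<in> {1..T} \<Longrightarrow>
      inj_on (\<lambda>\<xi>. history \<theta>stg t (E *v \<xi>)) (range (history stg t))"
    and breakpoints: "\<And>i. z i 0 = (INF \<theta>\<in>transformed_support E G \<Xi>. \<theta> $ i)"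
      "\<And>i. z i (J i) = (SUP \<theta>\<in>transformed_support E G \<Xi>. \<theta> $ i)"
      "\<And>i j. j < J i \<Longrightarrow> z i j < z i (Suc j)"
    and index: "lifted_index J coord piece"
  shows "\<exists>\<Psi>' :: (real ^ 'k) set.
      \<Psi>' \<subseteq> (\<Union>g\<in>{1..G}. outer_approx E z coord piece \<Xi> g) \<and>
      retract_op E z coord ` \<Psi>' = (\<Union>g\<in>{1..G}. \<Xi> g) \<and>
      (\<forall>x' \<in> feasible (affine_rules (lifted_problem \<theta>stg dstg E z coord G A b c
                (distr P borel (lift_op E z coord piece)) (outer_approx E z coord piece \<Xi>))).
        \<exists>x \<in> feasible (affine_rules (multistage_problem stg dstg G A b c P \<Xi>)).
          \<forall>\<xi>'\<in>\<Psi>'. x' \<xi>' = x (retract_op E z coord \<xi>'))"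
proof -
  let ?D = "\<lambda>\<xi>. fill_pieces z coord piece (grid_normalise z J (E *v \<xi>))"
  let ?\<Theta> = "(\<lambda>\<xi>. E *v \<xi>) ` \<Xi> 1"
  let ?R = "retract_op E z coord"
  have support: "transformed_support E G \<Xi> = ?\<Theta>"
    by (simp add: transformed_support_def \<open>G = 1\<close>)
  note ends = breakpoints(1,2)[unfolded support]

  have "compact ?\<Theta>"
    using compact[of 1] \<open>G = 1\<close>
    by (intro compact_continuous_image matrix_vector_mult_linear_continuous_on) auto
  then have "compact ((\<lambda>\<theta>. \<theta> $ i) ` ?\<Theta>)" for i
    by (intro compact_continuous_image[where s = ?\<Theta>] continuous_intros)
  then have "bdd_below ((\<lambda>\<theta>. \<theta> $ i) ` ?\<Theta>)" "bdd_above ((\<lambda>\<theta>. \<theta> $ i) ` ?\<Theta>)" for i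
    by (simp_all only: compact_imp_bounded bounded_imp_bdd_below bounded_imp_bdd_above)
  then have grid: "z i 0 \<le> (E *v \<xi>) $ i \<and> (E *v \<xi>) $ i \<le> z i (J i)" if "\<xi> \<in> \<Xi> 1" for \<xi> i
    unfolding ends using that by (auto intro: cINF_lower cSUP_upper)

  \<comment> \<open>The history up to the last stage is the whole vector, and there is a last stage because
    some coordinate carries a stage between \<open>1\<close> and \<open>T\<close>.\<close>
  have "history stg T \<xi> = \<xi>" "history \<theta>stg T \<theta> = \<theta>" for \<xi> \<theta>
    using stages(1,2) by (simp_all add: history_def vec_eq_iff)
  moreover have "T \<in> {1..T}" using stages(1) by fastforce
  ultimately have inj: "inj (\<lambda>\<xi>. E *v \<xi>)"
    using E_inj[of T] by (simp add: image_def)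
  have retract: "?R (?D \<xi>) = \<xi>" if "\<xi> \<in> \<Xi> 1" for \<xi>
    using grid[OF that]
    by (simp add: retract_op_def unfold_fill_grid_normalise[OF index]
        left_inverse_mult_vector[OF inj])
  have outer: "?D \<xi> \<in> outer_approx E z coord piece \<Xi> 1" if "\<xi> \<in> \<Xi> 1" for \<xi>
    by (rule affine_lift_in_outer_approx[where z = z and J = J and \<Xi> = \<Xi> and g = 1,
          OF index breakpoints(3) ends grid that])
  have affine_D: "affine_map ?D"
    by (rule affine_map_compose[OF linear_imp_affine_map[OF linear_fill_pieces]
          affine_map_compose[OF affine_map_grid_normalise
            linear_imp_affine_map[OF matrix_vector_mul_linear]]])

  show ?thesis
  proof (intro exI[of _ "?D ` \<Xi> 1"] conjI ballI)
    show "?D ` \<Xi> 1 \<subseteq> (\<Union>g\<in>{1..G}. outer_approx E z coord piece \<Xi> g)"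
      using outer \<open>G = 1\<close> by auto
    show "?R ` ?D ` \<Xi> 1 = (\<Union>g\<in>{1..G}. \<Xi> g)"
      using retract \<open>G = 1\<close> by (force simp: image_image)
  next
    fix x' assume "x' \<in> feasible (affine_rules (lifted_problem \<theta>stg dstg E z coord G A b c
      (distr P borel (lift_op E z coord piece)) (outer_approx E z coord piece \<Xi>)))"
    then have x': "x' \<in> nonanticipative (\<theta>stg \<circ> coord) dstg" "affine_map x'"
      and le: "\<And>\<xi>'. \<xi>' \<in> outer_approx E z coord piece \<Xi> 1 \<Longrightarrow> A 1 *v x' \<xi>' \<le> b 1 (?R \<xi>')"
      using \<open>G = 1\<close>
      by (auto simp: affine_rules_def lifted_problem_def multistage_problem_def)
    show "\<exists>x \<in> feasible (affine_rules (multistage_problem stg dstg G A b c P \<Xi>)).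
        \<forall>\<xi>'\<in>?D ` \<Xi> 1. x' \<xi>' = x (?R \<xi>')"
    proof (intro bexI[of _ "\<lambda>\<xi>. x' (?D \<xi>)"] ballI)
      show "x' \<xi>' = x' (?D (?R \<xi>'))" if "\<xi>' \<in> ?D ` \<Xi> 1" for \<xi>'
        using that retract by auto
      have "affine_map (\<lambda>\<xi>. x' (?D \<xi>))"
        by (rule affine_map_compose[OF x'(2) affine_D])
      moreover have "(\<lambda>\<xi>. x' (?D \<xi>)) \<in> nonanticipative stg dstg"
        by (rule nonanticipative_compose_affine_lift[OF E_causal x'(1)])
      moreover have "A 1 *v x' (?D \<xi>) \<le> b 1 \<xi>" if "\<xi> \<in> \<Xi> 1" for \<xi>
        using le[OF outer[OF that]] retract[OF that] by simp
      ultimately show "(\<lambda>\<xi>. x' (?D \<xi>))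
          \<in> feasible (affine_rules (multistage_problem stg dstg G A b c P \<Xi>))"
        by (simp add: affine_rules_def multistage_problem_def \<open>G = 1\<close>)
    qed
  qed
qed

end
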